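(* Let $\mathbb{F}$ be a field, let $n\ge 1$, and let $B$ be a nonzero matrix in $M_n(\mathbb{F})$. Then $B$ is strongly independent over $\mathbb{F}$ if and only if the characteristic polynomial $P_B(t)=\det(tI_n-B)$ is irreducible in $\mathbb{F}[t]$.
   Context: An $n$-tuple $(B_1,\dots,B_n)$ of matrices in $M_n(\mathbb{F})$ is called strongly independent over $\mathbb{F}$ if for every nonzero column vector $v\in\mathbb{F}^{n\times 1}$, the vectors $B_1v,\dots,B_nv$ are linearly independent over $\mathbb{F}$. A nonzero matrix $B\in M_n(\mathbb{F})$ is called strongly independent over $\mathbb{F}$ if the $n$-tuple $(I_n,B,B^2,\dots,B^{n-1})$ is strongly independent over $\mathbb{F}$. *)

theory Defs
  imports "Jordan_Normal_Form.Char_Poly"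
begin

text \<open>An n-tuple (B_0,...,B_{n-1}) of n x n matrices is strongly independent if for every
  nonzero v in F^n the vectors B_0 v, ..., B_{n-1} v are linearly independent
  (as a family: only the trivial linear combination vanishes).\<close>
definition strongly_independent_tuple :: "nat \<Rightarrow> (nat \<Rightarrow> 'a::field mat) \<Rightarrow> bool" where
  "strongly_independent_tuple n Bs \<longleftrightarrow>
     (\<forall>v \<in> carrier_vec n. v \<noteq> 0\<^sub>v n \<longrightarrow>
        (\<forall>c :: nat \<Rightarrow> 'a.
           (\<forall>j<n. (\<Sum>i<n. c i * (Bs i *\<^sub>v v) $ j) = 0) \<longrightarrow> (\<forall>i<n. c i = 0)))"

text \<open>A nonzero n x n matrix B is strongly independent if (I, B, ..., B^(n-1)) is.\<close>
definition strongly_independent_mat :: "nat \<Rightarrow> 'a::field mat \<Rightarrow> bool" where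
  "strongly_independent_mat n B \<longleftrightarrow>
     B \<noteq> 0\<^sub>m n n \<and> strongly_independent_tuple n (\<lambda>i. B ^\<^sub>m i)"

end

(* Write p(B) for a polynomial evaluated at B. Strong independence of (I, B, ..., B^(n-1)) says
   exactly that no nonzero vector is annihilated by a nonzero polynomial of degree < n. By
   Cayley-Hamilton, which follows by comparing coefficients in (tI - B) adj(tI - B) = P_B(t) I,
   every vector is annihilated by P_B, of degree n. If P_B = f g with f, g of positive degree, then
   for v <> 0 either g(B) v = 0 or f annihilates g(B) v <> 0. Conversely, the annihilators of a
   vector v <> 0 are the multiples of one of least degree; it divides P_B and is not a unit, so
   it is associate to P_B when P_B is irreducible. *)

theory Submission
  imports Defs
begin

definition poly_mat :: "'a::comm_ring_1 poly \<Rightarrow> 'a mat \<Rightarrow> 'a mat" where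
  "poly_mat p B = fold_coeffs (\<lambda>a M. a \<cdot>\<^sub>m 1\<^sub>m (dim_row B) + B * M) p (0\<^sub>m (dim_row B) (dim_row B))"

context
  fixes B :: "'a::comm_ring_1 mat" and n :: nat
  assumes B: "B \<in> carrier_mat n n"
begin

lemma poly_mat_0 [simp]: "poly_mat 0 B = 0\<^sub>m n n"
  using B by (simp add: poly_mat_def)

lemma poly_mat_pCons: "poly_mat (pCons a p) B = a \<cdot>\<^sub>m 1\<^sub>m n + B * poly_mat p B"
proof (cases "a = 0 \<and> p = 0")
  case True
  then show ?thesis using B by (auto simp: poly_mat_def)
next
  case False
  then show ?thesis using B by (auto simp: poly_mat_def fold_coeffs_pCons_not_0_0_eq)
qed

lemma poly_mat_carrier [simp]: "poly_mat p B \<in> carrier_mat n n"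
  by (induction p) (use B in \<open>simp_all add: poly_mat_pCons\<close>)

lemma poly_mat_dim [simp]: "dim_row (poly_mat p B) = n" "dim_col (poly_mat p B) = n"
  using poly_mat_carrier[of p] unfolding carrier_mat_def by auto

lemma poly_mat_const [simp]: "poly_mat [:a:] B = a \<cdot>\<^sub>m 1\<^sub>m n"
  using B by (simp add: poly_mat_pCons)

lemma poly_mat_1 [simp]: "poly_mat 1 B = 1\<^sub>m n"
  using poly_mat_const[of 1] by (simp add: one_pCons) (rule eq_matI, auto)

lemma poly_mat_add: "poly_mat (p + q) B = poly_mat p B + poly_mat q B"
proof (induction p arbitrary: q)
  case (pCons a p)
  obtain b q' where q: "q = pCons b q'" by (cases q)
  have "B * (poly_mat p B + poly_mat q' B) = B * poly_mat p B + B * poly_mat q' B"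
    by (rule mult_add_distrib_mat[OF B poly_mat_carrier poly_mat_carrier])
  then show ?case using pCons.IH B unfolding q
    by (simp add: poly_mat_pCons) (rule eq_matI, auto simp: algebra_simps)
qed simp

lemma poly_mat_smult: "poly_mat (Polynomial.smult a p) B = a \<cdot>\<^sub>m poly_mat p B"
proof (induction p)
  case (pCons b p)
  have "B * (a \<cdot>\<^sub>m poly_mat p B) = a \<cdot>\<^sub>m (B * poly_mat p B)"
    by (rule mult_smult_distrib[OF B poly_mat_carrier])
  then show ?case using pCons.IH B
    by (simp add: poly_mat_pCons) (rule eq_matI, auto simp: algebra_simps)
qed simp

lemma poly_mat_mult: "poly_mat (p * q) B = poly_mat p B * poly_mat q B"
proof (induction p)
  case (pCons a p)
  have "(a \<cdot>\<^sub>m 1\<^sub>m n + B * poly_mat p B) * poly_mat q B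
      = a \<cdot>\<^sub>m poly_mat q B + B * poly_mat p B * poly_mat q B"
    using B by (simp add: add_mult_distrib_mat[of _ n n _ _ n] mult_smult_assoc_mat[of _ n n _ n])
  then show ?case using pCons.IH B
    by (simp add: poly_mat_add poly_mat_smult poly_mat_pCons
        assoc_mult_mat[OF B poly_mat_carrier poly_mat_carrier])
       (rule eq_matI, auto)
qed simp

lemma poly_mat_commute: "B * poly_mat p B = poly_mat p B * B"
proof (induction p)
  case (pCons a p)
  have "B * (B * poly_mat p B) = (B * poly_mat p B) * B"
    by (metis assoc_mult_mat[OF B poly_mat_carrier B] pCons.IH)
  then show ?case
    using B by (simp add: poly_mat_pCons mult_add_distrib_mat[of B n n _ n]
        mult_smult_distrib[of B n n _ n] add_mult_distrib_mat[of _ n n _ _ n]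
        mult_smult_assoc_mat[of _ n n _ n])
qed (use B in simp)

lemma poly_mat_add_mult_vec:
  "v \<in> carrier_vec n \<Longrightarrow> poly_mat (p + q) B *\<^sub>v v = poly_mat p B *\<^sub>v v + poly_mat q B *\<^sub>v v"
  by (simp add: poly_mat_add add_mult_distrib_mat_vec[OF poly_mat_carrier poly_mat_carrier])

lemma poly_mat_mult_mult_vec:
  "v \<in> carrier_vec n \<Longrightarrow> poly_mat (p * q) B *\<^sub>v v = poly_mat p B *\<^sub>v (poly_mat q B *\<^sub>v v)"
  by (simp add: poly_mat_mult assoc_mult_mat_vec[OF poly_mat_carrier poly_mat_carrier])

lemma poly_mat_mult_vec_index:
  assumes "v \<in> carrier_vec n" and "i < n" and "degree p < K"
  shows "(poly_mat p B *\<^sub>v v) $ i = (\<Sum>k<K. coeff p k * (B ^\<^sub>m k *\<^sub>v v) $ i)"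
  using assms(1,3)
proof (induction p arbitrary: v K)
  case (pCons a p)
  obtain K' where K: "K = Suc K'" using pCons.prems(2) by (cases K) auto
  have Bv: "B *\<^sub>v v \<in> carrier_vec n" using B pCons.prems(1) by simp
  have "poly_mat (pCons a p) B *\<^sub>v v = a \<cdot>\<^sub>v v + poly_mat p B *\<^sub>v (B *\<^sub>v v)"
    using B pCons.prems(1)
    by (simp add: poly_mat_pCons poly_mat_commute)
       (subst add_mult_distrib_mat_vec[of _ n n],
        auto simp: assoc_mult_mat_vec[OF poly_mat_carrier B])
  then have "(poly_mat (pCons a p) B *\<^sub>v v) $ i = a * v $ i + (poly_mat p B *\<^sub>v (B *\<^sub>v v)) $ i"
    using pCons.prems(1) \<open>i < n\<close> by simp
  also have "(poly_mat p B *\<^sub>v (B *\<^sub>v v)) $ i = (\<Sum>k<K'. coeff p k * (B ^\<^sub>m Suc k *\<^sub>v v) $ i)"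
  proof (cases "p = 0")
    case False
    then have "degree p < K'" using pCons.prems(2) K by simp
    then show ?thesis
      using pCons.IH[OF Bv] B pCons.prems(1) by (simp add: assoc_mult_mat_vec[of _ n n B n])
  qed (use \<open>i < n\<close> Bv in simp)
  finally show ?case
    using B pCons.prems(1) \<open>i < n\<close> unfolding K sum.lessThan_Suc_shift by simp
qed (use \<open>i < n\<close> in simp)

end

definition coeff_mat :: "'a::zero poly mat \<Rightarrow> nat \<Rightarrow> 'a mat" where
  "coeff_mat P k = map_mat (\<lambda>p. coeff p k) P"

lemma coeff_mat_dim [simp]:
  "dim_row (coeff_mat P k) = dim_row P" "dim_col (coeff_mat P k) = dim_col P"
  by (simp_all add: coeff_mat_def)

lemma coeff_mat_eventually_zero:
  assumes "P \<in> carrier_mat nr nc"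
  obtains N where "\<And>k. N \<le> k \<Longrightarrow> coeff_mat P k = 0\<^sub>m nr nc"
proof -
  have "\<forall>\<^sub>\<infinity>k. \<forall>ij \<in> {0..<nr} \<times> {0..<nc}. coeff (P $$ ij) k = 0"
    by (simp add: eventually_ball_finite MOST_coeff_eq_0)
  then obtain N where "\<And>k i j. N \<le> k \<Longrightarrow> i < nr \<Longrightarrow> j < nc \<Longrightarrow> coeff (P $$ (i,j)) k = 0"
    unfolding cofinite_eq_sequentially eventually_sequentially by force
  then show ?thesis
    using assms by (intro that eq_matI) (auto simp: coeff_mat_def)
qed

context
  fixes B :: "'a::comm_ring_1 mat" and n :: nat
  assumes B: "B \<in> carrier_mat n n"
begin

text \<open>The coefficient of t^k in (tI - B) adj(tI - B) = P_B(t) I.\<close>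

lemma coeff_char_poly_adj_identity:
  defines "P \<equiv> adj_mat (char_poly_matrix B)"
  shows "coeff (char_poly B) k \<cdot>\<^sub>m 1\<^sub>m n
    = (if k = 0 then 0\<^sub>m n n else coeff_mat P (k - 1)) - B * coeff_mat P k" (is "_ = ?R")
proof -
  have M: "char_poly_matrix B \<in> carrier_mat n n" using B by simp
  have P: "P \<in> carrier_mat n n" unfolding P_def using adj_mat(1)[OF M] .
  have MP: "char_poly_matrix B * P = char_poly B \<cdot>\<^sub>m 1\<^sub>m n"
    unfolding P_def char_poly_def using adj_mat(2)[OF M] .
  show ?thesis
  proof (rule eq_matI)
    fix i j assume "i < dim_row ?R" "j < dim_col ?R"
    then have i: "i < n" and j: "j < n" using B P by (auto simp: coeff_mat_def)
    have "(char_poly B \<cdot>\<^sub>m 1\<^sub>m n) $$ (i,j) = (\<Sum>l<n. char_poly_matrix B $$ (i,l) * P $$ (l,j))"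
      unfolding MP[symmetric] using M P i j by (simp add: scalar_prod_def lessThan_atLeast0)
    also have "\<dots> = (\<Sum>l<n. (if i = l then [:0,1:] * P $$ (l,j) else 0)
                              + [:- B $$ (i,l):] * P $$ (l,j))"
      using B i by (intro sum.cong) (auto simp: char_poly_matrix_def distrib_right)
    also have "\<dots> = [:0,1:] * P $$ (i,j) + (\<Sum>l<n. [:- B $$ (i,l):] * P $$ (l,j))"
      using i by (subst sum.distrib) simp
    finally have "coeff ((char_poly B \<cdot>\<^sub>m 1\<^sub>m n) $$ (i,j)) k
      = coeff ([:0,1:] * P $$ (i,j) + (\<Sum>l<n. [:- B $$ (i,l):] * P $$ (l,j))) k"
      by (rule arg_cong)
    then have "(if i = j then coeff (char_poly B) k else 0)
      = (if k = 0 then 0 else coeff (P $$ (i,j)) (k - 1))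
        - (\<Sum>l<n. B $$ (i,l) * coeff (P $$ (l,j)) k)"
      using i j by (cases k) (auto simp: coeff_sum sum_negf)
    then show "(coeff (char_poly B) k \<cdot>\<^sub>m 1\<^sub>m n) $$ (i,j) = ?R $$ (i,j)"
      using B P i j by (auto simp: coeff_mat_def scalar_prod_def lessThan_atLeast0 split: if_splits)
  qed (use B P in \<open>auto simp: coeff_mat_def\<close>)
qed

theorem cayley_hamilton: "poly_mat (char_poly B) B = 0\<^sub>m n n"
proof -
  define P where "P = adj_mat (char_poly_matrix B)"
  have P: "P \<in> carrier_mat n n" using B by (simp add: P_def adj_mat(1))
  have coeff_P: "coeff_mat P k \<in> carrier_mat n n" for k using P by (simp add: coeff_mat_def)
  define G where "G k = B ^\<^sub>m k * (if k = 0 then 0\<^sub>m n n else coeff_mat P (k - 1))" for k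
  have telescope: "coeff (char_poly B) k \<cdot>\<^sub>m B ^\<^sub>m k = G k - G (Suc k)" for k
  proof -
    have "coeff (char_poly B) k \<cdot>\<^sub>m B ^\<^sub>m k = B ^\<^sub>m k * (coeff (char_poly B) k \<cdot>\<^sub>m 1\<^sub>m n)"
      using B by (simp add: mult_smult_distrib[of _ n n "1\<^sub>m n" n])
    also have "\<dots> = B ^\<^sub>m k * ((if k = 0 then 0\<^sub>m n n else coeff_mat P (k - 1)) - B * coeff_mat P k)"
      unfolding P_def coeff_char_poly_adj_identity ..
    also have "\<dots> = G k - B ^\<^sub>m k * B * coeff_mat P k"
      using B coeff_P
      by (simp add: G_def assoc_mult_mat[OF pow_carrier_mat[OF B] B coeff_P]
          mult_minus_distrib_mat[OF pow_carrier_mat[OF B] _ mult_carrier_mat[OF B coeff_P]])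
    finally show ?thesis by (simp add: G_def)
  qed
  obtain N where N: "\<And>k. N \<le> k \<Longrightarrow> coeff_mat P k = 0\<^sub>m n n"
    using coeff_mat_eventually_zero[OF P] by blast
  define K where "K = Suc (N + degree (char_poly B))"
  show ?thesis
  proof (rule eq_matI)
    fix i j assume "i < dim_row (0\<^sub>m n n :: 'a mat)" "j < dim_col (0\<^sub>m n n :: 'a mat)"
    then have i: "i < n" and j: "j < n" by auto
    have "poly_mat (char_poly B) B $$ (i,j) = (poly_mat (char_poly B) B *\<^sub>v unit_vec n j) $ i"
      using B i j by simp
    also have "\<dots> = (\<Sum>k<K. coeff (char_poly B) k * (B ^\<^sub>m k *\<^sub>v unit_vec n j) $ i)"
      by (rule poly_mat_mult_vec_index) (use B i in \<open>simp_all add: K_def\<close>)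
    also have "\<dots> = (\<Sum>k<K. G k $$ (i,j) - G (Suc k) $$ (i,j))"
    proof (rule sum.cong)
      fix k
      have "coeff (char_poly B) k * (B ^\<^sub>m k *\<^sub>v unit_vec n j) $ i = (G k - G (Suc k)) $$ (i,j)"
        unfolding telescope[symmetric] using B i j by simp
      then show "coeff (char_poly B) k * (B ^\<^sub>m k *\<^sub>v unit_vec n j) $ i
        = G k $$ (i,j) - G (Suc k) $$ (i,j)"
        using B P i j by (simp add: G_def)
    qed simp
    also have "\<dots> = G 0 $$ (i,j) - G K $$ (i,j)"
      by (rule sum_lessThan_telescope')
    also have "\<dots> = 0"
      using B N i j by (simp add: G_def K_def)
    finally show "poly_mat (char_poly B) B $$ (i,j) = 0\<^sub>m n n $$ (i,j)"
      using i j by simp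
  qed (use B in simp_all)
qed

lemma cayley_hamilton_mult_vec:
  "v \<in> carrier_vec n \<Longrightarrow> poly_mat (char_poly B) B *\<^sub>v v = 0\<^sub>v n"
  by (auto simp: cayley_hamilton intro!: eq_vecI)

end

text \<open>Over a field this says that v, Bv, ..., B^(n-1) v is a basis of F^n.\<close>

definition cyclic_vector :: "nat \<Rightarrow> 'a::comm_ring_1 mat \<Rightarrow> 'a vec \<Rightarrow> bool" where
  "cyclic_vector n B v \<longleftrightarrow> (\<forall>p. p \<noteq> 0 \<longrightarrow> poly_mat p B *\<^sub>v v = 0\<^sub>v n \<longrightarrow> n \<le> degree p)"

context
  fixes B :: "'a::field mat" and n :: nat
  assumes B: "B \<in> carrier_mat n n"
begin

lemma strongly_independent_tuple_powers_iff:
  "strongly_independent_tuple n (\<lambda>i. B ^\<^sub>m i) \<longleftrightarrow>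
    (\<forall>v \<in> carrier_vec n. v \<noteq> 0\<^sub>v n \<longrightarrow> cyclic_vector n B v)"
  unfolding strongly_independent_tuple_def cyclic_vector_def
proof (intro iffI ballI impI allI)
  fix v :: "'a vec" and p
  assume indep: "\<forall>v\<in>carrier_vec n. v \<noteq> 0\<^sub>v n \<longrightarrow>
      (\<forall>c. (\<forall>j<n. (\<Sum>i<n. c i * (B ^\<^sub>m i *\<^sub>v v) $ j) = 0) \<longrightarrow> (\<forall>i<n. c i = 0))"
    and v: "v \<in> carrier_vec n" "v \<noteq> 0\<^sub>v n" and p: "p \<noteq> 0" "poly_mat p B *\<^sub>v v = 0\<^sub>v n"
  show "n \<le> degree p"
  proof (rule ccontr)
    assume "\<not> n \<le> degree p"
    then have deg: "degree p < n" by simp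
    have "(\<Sum>i<n. coeff p i * (B ^\<^sub>m i *\<^sub>v v) $ j) = 0" if "j < n" for j
      using poly_mat_mult_vec_index[OF B v(1) that deg] p(2) that by simp
    then have "coeff p i = 0" for i
      using indep v deg by (cases "i < n") (auto intro: coeff_eq_0)
    then show False using p(1) by (simp add: poly_eq_iff)
  qed
next
  fix v :: "'a vec" and c :: "nat \<Rightarrow> 'a" and i
  assume cyclic: "\<forall>v\<in>carrier_vec n. v \<noteq> 0\<^sub>v n \<longrightarrow>
      (\<forall>p. p \<noteq> 0 \<longrightarrow> poly_mat p B *\<^sub>v v = 0\<^sub>v n \<longrightarrow> n \<le> degree p)"
    and v: "v \<in> carrier_vec n" "v \<noteq> 0\<^sub>v n"
    and rel: "\<forall>j<n. (\<Sum>i<n. c i * (B ^\<^sub>m i *\<^sub>v v) $ j) = 0" and i: "i < n"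
  define p where "p = (\<Sum>i<n. monom (c i) i)"
  have coeff_p: "coeff p k = (if k < n then c k else 0)" for k
    by (simp add: p_def coeff_sum coeff_monom)
  show "c i = 0"
  proof (cases "p = 0")
    case False
    then have deg: "degree p < n"
      using coeff_p[of "degree p"] leading_coeff_neq_0 by (metis (full_types))
    have "poly_mat p B *\<^sub>v v = 0\<^sub>v n"
    proof (rule eq_vecI)
      fix j assume "j < dim_vec (0\<^sub>v n :: 'a vec)"
      then have j: "j < n" by simp
      show "(poly_mat p B *\<^sub>v v) $ j = 0\<^sub>v n $ j"
        using poly_mat_mult_vec_index[OF B v(1) j deg] rel j by (simp add: coeff_p)
    qed (use B in simp)
    then have "n \<le> degree p" using cyclic v False by blast
    with deg show ?thesis by simp
  qed (use coeff_p[of i] i in simp)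
qed

lemma least_degree_annihilator_dvd:
  assumes v: "v \<in> carrier_vec n"
    and d: "d \<noteq> 0" "poly_mat d B *\<^sub>v v = 0\<^sub>v n"
    and least: "\<And>q. q \<noteq> 0 \<Longrightarrow> poly_mat q B *\<^sub>v v = 0\<^sub>v n \<Longrightarrow> degree d \<le> degree q"
    and q: "poly_mat q B *\<^sub>v v = 0\<^sub>v n"
  shows "d dvd q"
proof (rule ccontr)
  assume "\<not> d dvd q"
  then have r: "q mod d \<noteq> 0" by (simp add: mod_eq_0_iff_dvd)
  have "poly_mat q B *\<^sub>v v = poly_mat (q mod d + q div d * d) B *\<^sub>v v"
    by simp
  also have "\<dots> = poly_mat (q mod d) B *\<^sub>v v + poly_mat (q div d) B *\<^sub>v (poly_mat d B *\<^sub>v v)"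
    by (simp only: poly_mat_add_mult_vec[OF B v] poly_mat_mult_mult_vec[OF B v])
  also have "poly_mat (q div d) B *\<^sub>v (poly_mat d B *\<^sub>v v) = 0\<^sub>v n"
    using B d(2) by (intro eq_vecI) auto
  finally have "poly_mat (q mod d) B *\<^sub>v v = 0\<^sub>v n"
    using mult_mat_vec_carrier[OF poly_mat_carrier[OF B] v] q by simp
  then have "degree d \<le> degree (q mod d)" using least r by blast
  with degree_mod_less'[OF d(1) r] show False by simp
qed

lemma irreducible_char_poly_imp_cyclic_vector:
  assumes irr: "irreducible (char_poly B)" and v: "v \<in> carrier_vec n" "v \<noteq> 0\<^sub>v n"
  shows "cyclic_vector n B v"
  unfolding cyclic_vector_def
proof (intro allI impI)
  fix p assume p: "p \<noteq> 0" "poly_mat p B *\<^sub>v v = 0\<^sub>v n"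
  obtain d where d: "d \<noteq> 0" "poly_mat d B *\<^sub>v v = 0\<^sub>v n"
    and least: "\<And>q. q \<noteq> 0 \<Longrightarrow> poly_mat q B *\<^sub>v v = 0\<^sub>v n \<Longrightarrow> degree d \<le> degree q"
    using ex_has_least_nat[of "\<lambda>q. q \<noteq> 0 \<and> poly_mat q B *\<^sub>v v = 0\<^sub>v n" p degree] p by blast
  have "d dvd char_poly B"
    using v(1) d least cayley_hamilton_mult_vec[OF B v(1)] by (rule least_degree_annihilator_dvd)
  then obtain e where e: "char_poly B = d * e" ..
  have "\<not> is_unit d"
  proof
    assume "is_unit d"
    then obtain k where "1 = d * k" by (elim dvdE)
    then have "v = poly_mat k B *\<^sub>v (poly_mat d B *\<^sub>v v)"
      using B v by (simp flip: poly_mat_mult_mult_vec add: mult.commute)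
    with d(2) v B show False by (auto intro!: eq_vecI)
  qed
  then have "is_unit e" using irr e by (auto dest: irreducibleD)
  then have "degree (char_poly B) = degree d"
    using e d(1) by (auto simp: degree_mult_eq is_unit_iff_degree)
  then show "n \<le> degree p"
    using degree_monic_char_poly[OF B] least[OF p] by simp
qed

lemma irreducible_char_poly_if_cyclic_vectors:
  assumes n: "n \<ge> 1" and cyclic: "\<And>v. v \<in> carrier_vec n \<Longrightarrow> v \<noteq> 0\<^sub>v n \<Longrightarrow> cyclic_vector n B v"
  shows "irreducible (char_poly B)"
proof (rule irreducibleI)
  have deg: "degree (char_poly B) = n" using degree_monic_char_poly[OF B] by simp
  then show nz: "char_poly B \<noteq> 0" "\<not> is_unit (char_poly B)"
    using n by (auto simp: is_unit_iff_degree)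
  fix f g assume fg: "char_poly B = f * g"
  show "is_unit f \<or> is_unit g"
  proof (rule ccontr)
    assume "\<not> (is_unit f \<or> is_unit g)"
    moreover have "f \<noteq> 0" "g \<noteq> 0" using fg nz by auto
    ultimately have "degree f \<noteq> 0" "degree g \<noteq> 0" by (auto simp: is_unit_iff_degree)
    moreover have "degree f + degree g = n"
      using fg deg \<open>f \<noteq> 0\<close> \<open>g \<noteq> 0\<close> by (simp add: degree_mult_eq)
    ultimately have low: "degree f < n" "degree g < n" by auto
    define v :: "'a vec" where "v = unit_vec n 0"
    have v: "v \<in> carrier_vec n" "v \<noteq> 0\<^sub>v n" using n by (auto simp: v_def)
    have "poly_mat g B *\<^sub>v v \<noteq> 0\<^sub>v n"
      using cyclic[OF v] \<open>g \<noteq> 0\<close> low by (auto simp: cyclic_vector_def)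
    moreover have "poly_mat f B *\<^sub>v (poly_mat g B *\<^sub>v v) = 0\<^sub>v n"
      using v B by (simp flip: poly_mat_mult_mult_vec fg add: cayley_hamilton_mult_vec)
    moreover have "poly_mat g B *\<^sub>v v \<in> carrier_vec n"
      using mult_mat_vec_carrier[OF poly_mat_carrier[OF B] v(1)] .
    ultimately show False
      using cyclic[of "poly_mat g B *\<^sub>v v"] \<open>f \<noteq> 0\<close> low by (auto simp: cyclic_vector_def)
  qed
qed

end

theorem theorem1p5:
  fixes B :: "'a::field mat" and n :: nat
  assumes "n \<ge> 1" and "B \<in> carrier_mat n n" and "B \<noteq> 0\<^sub>m n n"
  shows "strongly_independent_mat n B \<longleftrightarrow> irreducible (char_poly B)"
proof -
  have "strongly_independent_mat n B \<longleftrightarrow> (\<forall>v \<in> carrier_vec n. v \<noteq> 0\<^sub>v n \<longrightarrow> cyclic_vector n B v)"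
    using assms by (simp add: strongly_independent_mat_def strongly_independent_tuple_powers_iff)
  also have "\<dots> \<longleftrightarrow> irreducible (char_poly B)"
    using assms irreducible_char_poly_imp_cyclic_vector irreducible_char_poly_if_cyclic_vectors
    by blast
  finally show ?thesis .
qed

end
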